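(* Let $p\ne0$ be a complex number and let $j,n$ be integers with $0\le j\le n$. (i) For all complex $x$, $$HC\left(p,\,j+\tfrac12,\,0,\,j-n,\,4p(j-n);\,x\right)=\frac{(2j)!}{j!}\sum_{k=0}^{n-j}\binom{n-j}{k}\frac{(n-k)!}{(2n-2k)!}(16px)^{n-j-k}.$$ (ii) More generally, for every real $\lambda>-1$ and all complex $x$, $$HC\left(p,\,j+1+\lambda,\,0,\,j-n,\,4p(j-n);\,x\right)=\frac{(\lambda+1)_j\,\Gamma(\lambda+1)}{\Gamma(n+\lambda+1)}\sum_{k=0}^{n-j}(\lambda+n+1-k)_k\binom{n-j}{k}(4px)^{n-j-k}.$$
   Context: Confluent Heun function: for $p\neq0$ and $\gamma\notin\{0,-1,-2,\dots\}$, $HC(p,\gamma,\delta,\alpha,\sigma;x)$ denotes the solution $u(x)$, analytic near $x=0$ and normalized by $u(0)=1$, of $$u''(x)+\left(4p+\frac{\gamma}{x}+\frac{\delta}{x-1}\right)u'(x)+\frac{4p\alpha x-\sigma}{x(x-1)}u(x)=0.$$ When $\delta=0$ and $\sigma=4p\alpha$ one has $\frac{4p\alpha x-\sigma}{x(x-1)}=\frac{4p\alpha}{x}$, the only finite singular point is $0$, and the function is understood as extended to all of $\mathbb{C}$. Notation: $(y)_0:=1$, $(y)_k:=y(y+1)\cdots(y+k-1)$ for $k\ge1$; $\Gamma$ is the Gamma function. *)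

theory Defs
  imports "HOL-Complex_Analysis.Complex_Analysis"
begin

text \<open>
  The equation is required on a punctured neighbourhood of \<open>0\<close> only, because its
  coefficients are singular at \<open>0\<close> (and, as written, at \<open>1\<close>).
\<close>

definition heun_local_solution ::
  "complex \<Rightarrow> complex \<Rightarrow> complex \<Rightarrow> complex \<Rightarrow> complex \<Rightarrow> (complex \<Rightarrow> complex) \<Rightarrow> bool" where
  "heun_local_solution p \<gamma> \<delta> \<alpha> \<sigma> u \<longleftrightarrow>
     u analytic_on {0} \<and> u 0 = 1 \<and>
     (\<forall>\<^sub>F x in at 0.
        deriv (deriv u) x + (4 * p + \<gamma> / x + \<delta> / (x - 1)) * deriv u x
          + (4 * p * \<alpha> * x - \<sigma>) / (x * (x - 1)) * u x = 0)"

text \<open>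
  The local solution continues holomorphically to the disc reaching the singular point \<open>1\<close>,
  and to the whole plane in the case where that singularity is absent.
\<close>

definition heun_domain :: "complex \<Rightarrow> complex \<Rightarrow> complex \<Rightarrow> complex \<Rightarrow> complex set" where
  "heun_domain p \<delta> \<alpha> \<sigma> = (if \<delta> = 0 \<and> \<sigma> = 4 * p * \<alpha> then UNIV else ball 0 1)"

text \<open>
  Meaningful for \<open>p \<noteq> 0\<close> and \<open>\<gamma> \<notin> {0, -1, -2, \<dots>}\<close>. Membership in \<open>extensional\<close> only
  fixes the irrelevant values off the domain, so that the description is unique.
\<close>

definition HC ::
  "complex \<Rightarrow> complex \<Rightarrow> complex \<Rightarrow> complex \<Rightarrow> complex \<Rightarrow> complex \<Rightarrow> complex" where
  "HC p \<gamma> \<delta> \<alpha> \<sigma> =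
     (THE u. heun_local_solution p \<gamma> \<delta> \<alpha> \<sigma> u \<and>
             u holomorphic_on heun_domain p \<delta> \<alpha> \<sigma> \<and>
             u \<in> extensional (heun_domain p \<delta> \<alpha> \<sigma>))"

end

theory Submission imports Defs begin

text \<open>
  At \<open>\<delta> = 0\<close>, \<open>\<sigma> = 4 p \<alpha>\<close> the apparent singularity at \<open>1\<close> cancels and Heun's equation becomes
  \<open>x u'' + (4 p x + \<gamma>) u' + 4 p \<alpha> u = 0\<close>, which is Kummer's equation in the variable \<open>-4 p x\<close>.
  On the coefficients \<open>c\<^sub>m\<close> of \<open>u\<close> at \<open>0\<close> it is the two-term recurrence
  \<open>(m + 1) (m + \<gamma>) c\<^sub>m\<^sub>+\<^sub>1 = -4 p (m + \<alpha>) c\<^sub>m\<close>: the equation and the recurrence are equivalent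
  (\<open>heun_equation_iff_recurrence\<close>). Since \<open>\<gamma>\<close> is not a nonpositive integer, the factor
  \<open>m + \<gamma>\<close> never vanishes, so the recurrence and \<open>c\<^sub>0 = 1\<close> determine the whole series.
  For \<open>\<alpha> = -N\<close> it stops after degree \<open>N\<close>, and the solution is the polynomial with
  \<open>c\<^sub>m = (N choose m) (4 p)\<^sup>m / (\<gamma>)\<^sub>m\<close>. By analytic continuation this is the only entire solution,
  hence the value of \<open>HC\<close> (\<open>HC_eq_confluent_poly\<close>).

  Both formulas are this polynomial with \<open>N = n - j\<close>, listed from the highest power down, so that
  \<open>m = n - j - k\<close>. What remains is to rewrite \<open>1 / (\<gamma>)\<^sub>m\<close>. For \<open>\<gamma> = j + 1 + \<lambda>\<close> the
  symbols \<open>(\<lambda> + 1)\<^sub>j\<close>, \<open>(\<gamma>)\<^sub>m\<close> and \<open>(\<lambda> + n + 1 - k)\<^sub>k\<close> run over consecutive blocks of factors and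
  multiply to \<open>(\<lambda> + 1)\<^sub>n = \<Gamma>(n + \<lambda> + 1) / \<Gamma>(\<lambda> + 1)\<close>; for \<open>\<gamma> = j + 1/2\<close> the symbol is a
  quotient of factorials, because \<open>(2 i)! = 4\<^sup>i i! (1/2)\<^sub>i\<close>.
\<close>

section \<open>The power series form of the equation\<close>

text \<open>
  The equivalence serves twice: one direction gives uniqueness of the solution, the other lets the
  polynomial solution be verified on its coefficients, with no derivative computed.
\<close>

lemma heun_equation_iff_recurrence:
  fixes u :: "complex \<Rightarrow> complex"
  assumes u: "u has_fps_expansion F"
  shows "(\<forall>\<^sub>F x in at 0.
            deriv (deriv u) x + (4 * p + \<gamma> / x + 0 / (x - 1)) * deriv u x
              + (4 * p * \<alpha> * x - 4 * p * \<alpha>) / (x * (x - 1)) * u x = 0) \<longleftrightarrow>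
         (\<forall>m. of_nat (Suc m) * (of_nat m + \<gamma>) * fps_nth F (Suc m)
                = - (4 * p * (of_nat m + \<alpha>)) * fps_nth F m)"
    (is "?ode \<longleftrightarrow> ?rec")
proof -
  \<comment> \<open>Multiplying the equation by \<open>x\<close> removes the poles. The second factor \<open>x\<close> makes the result
    vanish at \<open>0\<close> whatever \<open>u\<close> is, so that an identity near but not at \<open>0\<close> is one on a full
    neighbourhood and can be read off the power series.\<close>
  define R where "R = (\<lambda>x. x * (x * deriv (deriv u) x + (4 * p * x + \<gamma>) * deriv u x
                               + 4 * p * \<alpha> * u x))"
  define S where "S = fps_X * fps_deriv (fps_deriv F)
       + (fps_const (4 * p) * fps_X + fps_const \<gamma>) * fps_deriv F + fps_const (4 * p * \<alpha>) * F"
  have S: "R has_fps_expansion fps_X * S"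
    unfolding R_def S_def by (intro fps_expansion_intros u)
  have nz: "\<forall>\<^sub>F x in at 0. x \<noteq> (0::complex) \<and> x \<noteq> 1"
    by (simp add: eventually_conj eventually_neq_at_within)
  have "?ode \<longleftrightarrow> (\<forall>\<^sub>F x in at 0. R x = 0)"
  proof (rule eventually_cong[OF nz])
    fix x :: complex assume x: "x \<noteq> 0 \<and> x \<noteq> 1"
    have cancel: "(4 * p * \<alpha> * x - 4 * p * \<alpha>) / (x * (x - 1)) = 4 * p * \<alpha> / x"
      using x by (simp add: field_simps)
    have "R x = x\<^sup>2 * (deriv (deriv u) x + (4 * p + \<gamma> / x + 0 / (x - 1)) * deriv u x
                    + (4 * p * \<alpha> * x - 4 * p * \<alpha>) / (x * (x - 1)) * u x)"
    proof -
      have "x\<^sup>2 * (D2 + (4 * p + \<gamma> / x + 0 / (x - 1)) * D1 + 4 * p * \<alpha> / x * D0)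
              = x * (x * D2 + (4 * p * x + \<gamma>) * D1 + 4 * p * \<alpha> * D0)" for D0 D1 D2
        using x by (simp add: power2_eq_square distrib_left distrib_right)
      thus ?thesis unfolding cancel R_def by simp
    qed
    thus "(deriv (deriv u) x + (4 * p + \<gamma> / x + 0 / (x - 1)) * deriv u x
              + (4 * p * \<alpha> * x - 4 * p * \<alpha>) / (x * (x - 1)) * u x = 0) \<longleftrightarrow> R x = 0"
      using x by (simp only: mult_eq_0_iff power_eq_0_iff) simp
  qed
  also have "\<dots> \<longleftrightarrow> (\<forall>\<^sub>F x in nhds 0. R x = 0)"
    by (simp add: eventually_nhds_conv_at R_def)
  also have "\<dots> \<longleftrightarrow> S = 0"
  proof
    assume "\<forall>\<^sub>F x in nhds 0. R x = 0"
    hence "R has_fps_expansion 0" by (simp add: has_fps_expansion_0_iff)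
    hence "fps_X * S = 0" using fps_expansion_unique_complex[OF _ S] by simp
    thus "S = 0" by simp
  next
    assume "S = 0"
    thus "\<forall>\<^sub>F x in nhds 0. R x = 0" using S by (simp add: has_fps_expansion_0_iff)
  qed
  also have "\<dots> \<longleftrightarrow> ?rec"
  proof -
    have "fps_nth S m = of_nat (Suc m) * (of_nat m + \<gamma>) * fps_nth F (Suc m)
            + 4 * p * (of_nat m + \<alpha>) * fps_nth F m" for m
      by (cases m) (simp_all add: S_def ring_distribs mult.assoc algebra_simps)
    thus ?thesis by (auto simp: fps_eq_iff add_eq_0_iff2)
  qed
  finally show ?thesis .
qed

section \<open>The polynomial solution\<close>

text \<open>
  This is Kummer's hypergeometric polynomial \<open>M(-N; \<gamma>; -4 p x)\<close>.
\<close>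

definition confluent_poly :: "complex \<Rightarrow> complex \<Rightarrow> nat \<Rightarrow> complex \<Rightarrow> complex" where
  "confluent_poly p \<gamma> N x =
     (\<Sum>m\<le>N. of_nat (N choose m) / pochhammer \<gamma> m * (4 * p * x) ^ m)"

definition confluent_fps :: "complex \<Rightarrow> complex \<Rightarrow> nat \<Rightarrow> complex fps" where
  "confluent_fps p \<gamma> N = Abs_fps (\<lambda>m. of_nat (N choose m) / pochhammer \<gamma> m * (4 * p) ^ m)"

lemma confluent_poly_has_fps_expansion:
  "confluent_poly p \<gamma> N has_fps_expansion confluent_fps p \<gamma> N"
proof (rule has_fps_expansionI, rule always_eventually, rule allI)
  fix x
  have "(\<lambda>m. fps_nth (confluent_fps p \<gamma> N) m * x ^ m)
          sums (\<Sum>m\<le>N. fps_nth (confluent_fps p \<gamma> N) m * x ^ m)"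
    by (rule sums_finite) (auto simp: confluent_fps_def)
  thus "(\<lambda>m. fps_nth (confluent_fps p \<gamma> N) m * x ^ m) sums confluent_poly p \<gamma> N x"
    by (simp add: confluent_poly_def confluent_fps_def power_mult_distrib mult.assoc)
qed

lemma pochhammer_nonzero:
  fixes \<gamma> :: complex
  assumes "\<gamma> \<notin> \<int>\<^sub>\<le>\<^sub>0"
  shows "pochhammer \<gamma> m \<noteq> 0"
  using assms by (auto simp: pochhammer_eq_0_iff)

lemma confluent_fps_recurrence:
  assumes \<gamma>: "\<gamma> \<notin> \<int>\<^sub>\<le>\<^sub>0"
  shows "of_nat (Suc m) * (of_nat m + \<gamma>) * fps_nth (confluent_fps p \<gamma> N) (Suc m)
           = - (4 * p * (of_nat m + - of_nat N)) * fps_nth (confluent_fps p \<gamma> N) m"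
proof -
  let ?b = "\<lambda>m. of_nat (N choose m) :: complex"
  have binom: "of_nat (Suc m) * ?b (Suc m) = (of_nat N - of_nat m) * ?b m"
    using gbinomial_mult_1[of "of_nat N :: complex" m]
    by (simp add: binomial_gbinomial algebra_simps)
  have nz: "pochhammer \<gamma> m \<noteq> 0" "\<gamma> + of_nat m \<noteq> 0"
    using pochhammer_nonzero[OF \<gamma>, of m] pochhammer_nonzero[OF \<gamma>, of "Suc m"]
    by (auto simp: pochhammer_Suc)
  have "of_nat (Suc m) * (of_nat m + \<gamma>) * fps_nth (confluent_fps p \<gamma> N) (Suc m)
          = (of_nat (Suc m) * ?b (Suc m)) * (4 * p) ^ Suc m / pochhammer \<gamma> m"
    using nz by (simp add: confluent_fps_def pochhammer_Suc add.commute del: of_nat_Suc)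
  also have "\<dots> = - (4 * p * (of_nat m + - of_nat N)) * fps_nth (confluent_fps p \<gamma> N) m"
    unfolding binom using nz by (simp add: confluent_fps_def field_simps)
  finally show ?thesis .
qed

text \<open>
  The left factor of the recurrence is nonzero exactly because \<open>\<gamma>\<close> avoids \<open>0, -1, -2, \<dots>\<close>, so
  each coefficient can be solved for in terms of the previous one.
\<close>

lemma recurrence_unique:
  fixes F G :: "complex fps"
  assumes \<gamma>: "\<gamma> \<notin> \<int>\<^sub>\<le>\<^sub>0" and init: "fps_nth F 0 = fps_nth G 0"
    and F: "\<And>m. of_nat (Suc m) * (of_nat m + \<gamma>) * fps_nth F (Suc m) = c m * fps_nth F m"
    and G: "\<And>m. of_nat (Suc m) * (of_nat m + \<gamma>) * fps_nth G (Suc m) = c m * fps_nth G m"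
  shows "F = G"
proof (rule fps_ext)
  fix m show "fps_nth F m = fps_nth G m"
  proof (induction m)
    case (Suc m)
    have "of_nat m + \<gamma> \<noteq> 0"
      using pochhammer_nonzero[OF \<gamma>, of "Suc m"] by (auto simp: pochhammer_Suc add.commute)
    moreover have "of_nat (Suc m) * (of_nat m + \<gamma>) * fps_nth F (Suc m)
        = of_nat (Suc m) * (of_nat m + \<gamma>) * fps_nth G (Suc m)"
      using F[of m] G[of m] Suc.IH by (simp only:)
    ultimately show ?case by (simp del: of_nat_Suc)
  qed (rule init)
qed

text \<open>
  Any other solution has the same Taylor series at \<open>0\<close> and therefore agrees with the polynomial on
  the whole domain, which here is the plane.
\<close>

lemma HC_eq_confluent_poly:
  assumes \<gamma>: "\<gamma> \<notin> \<int>\<^sub>\<le>\<^sub>0"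
  shows "HC p \<gamma> 0 (- of_nat N) (4 * p * (- of_nat N)) = confluent_poly p \<gamma> N"
proof -
  let ?P = "confluent_poly p \<gamma> N" and ?F = "confluent_fps p \<gamma> N"
  note expansion = confluent_poly_has_fps_expansion[of p \<gamma> N]
  have dom: "heun_domain p 0 (- of_nat N) (4 * p * (- of_nat N)) = UNIV"
    by (simp add: heun_domain_def)
  have hol: "?P holomorphic_on UNIV"
    unfolding confluent_poly_def by (intro holomorphic_intros)
  have P0: "?P 0 = 1"
    by (simp add: confluent_poly_def power_0_left if_distrib cong: if_cong)
  have F0: "fps_nth ?F 0 = 1"
    by (simp add: confluent_fps_def)
  show ?thesis
    unfolding HC_def dom
  proof (rule the_equality)
    show "heun_local_solution p \<gamma> 0 (- of_nat N) (4 * p * (- of_nat N)) ?P \<and>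
          ?P holomorphic_on UNIV \<and> ?P \<in> extensional UNIV"
      unfolding heun_local_solution_def
    proof (intro conjI)
      show "?P analytic_on {0}"
        using hol by (simp add: analytic_on_holomorphic) blast
      show "\<forall>\<^sub>F x in at 0.
            deriv (deriv ?P) x + (4 * p + \<gamma> / x + 0 / (x - 1)) * deriv ?P x
              + (4 * p * (- of_nat N) * x - 4 * p * (- of_nat N)) / (x * (x - 1)) * ?P x = 0"
        using heun_equation_iff_recurrence[OF expansion] confluent_fps_recurrence[OF \<gamma>] by blast
    qed (use hol P0 in auto)
  next
    fix u
    assume "heun_local_solution p \<gamma> 0 (- of_nat N) (4 * p * (- of_nat N)) u \<and>
            u holomorphic_on UNIV \<and> u \<in> extensional UNIV"
    hence u0: "u 0 = 1" and u: "u holomorphic_on UNIV"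
      and ode: "\<forall>\<^sub>F x in at 0.
            deriv (deriv u) x + (4 * p + \<gamma> / x + 0 / (x - 1)) * deriv u x
              + (4 * p * (- of_nat N) * x - 4 * p * (- of_nat N)) / (x * (x - 1)) * u x = 0"
      unfolding heun_local_solution_def by blast+
    have u_exp: "u has_fps_expansion fps_expansion u 0"
      using u by (intro has_fps_expansion_fps_expansion) auto
    have "fps_expansion u 0 = ?F"
    proof (rule recurrence_unique[OF \<gamma>])
      show "fps_nth (fps_expansion u 0) 0 = fps_nth ?F 0"
        using u0 F0 by (simp add: fps_expansion_def)
    qed (use ode heun_equation_iff_recurrence[OF u_exp] confluent_fps_recurrence[OF \<gamma>] in blast)+
    hence "(\<lambda>x. u x - ?P x) has_fps_expansion 0"
      using has_fps_expansion_diff[OF u_exp expansion] by simp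
    hence "u x - ?P x = 0" for x
      using u hol by (intro has_fps_expansion_0_analytic_continuation[where A = UNIV])
        (auto intro!: holomorphic_intros)
    thus "u = ?P" by (intro ext) simp
  qed
qed

section \<open>Rewriting the coefficients\<close>

lemma confluent_poly_reversed:
  "confluent_poly p \<gamma> N x
     = (\<Sum>k = 0..N. of_nat (N choose k) / pochhammer \<gamma> (N - k) * (4 * p * x) ^ (N - k))"
  unfolding confluent_poly_def atLeast0AtMost
  by (subst sum.atLeastAtMost_rev[where n = 0, unfolded atLeast0AtMost])
    (auto intro!: sum.cong simp flip: binomial_symmetric)

text \<open>
  The rising factorial \<open>(j + 1/2)\<^sub>m\<close> is the quotient \<open>(1/2)\<^sub>j\<^sub>+\<^sub>m / (1/2)\<^sub>j\<close>, and both terms are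
  given by the duplication formula for factorials.
\<close>

lemma pochhammer_half_shifted:
  "pochhammer (of_nat j + 1/2) m =
     fact j / fact (2 * j) * (fact (2 * (j + m)) / (fact (j + m) * 4 ^ m) :: complex)"
proof -
  have half: "pochhammer (1/2) i = fact (2 * i) / (4 ^ i * fact i :: complex)" for i
    using fact_double[of i, where 'a = complex] by (simp add: power_mult)
  have "pochhammer (1/2 :: complex) (j + m) = pochhammer (1/2) j * pochhammer (1/2 + of_nat j) m"
    by (rule pochhammer_product')
  thus ?thesis
    unfolding half by (simp add: field_simps power_add)
qed

text \<open>
  The three rising factorials that start at \<open>a\<close>, \<open>a + j\<close> and \<open>a + j + m\<close>, of lengths \<open>j\<close>, \<open>m\<close>
  and \<open>k\<close>, concatenate to \<open>(a)\<^sub>n = \<Gamma>(a + n) / \<Gamma>(a)\<close>; the identity solves this for the middle one.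
\<close>

lemma inverse_pochhammer_Gamma:
  fixes a :: complex
  assumes a: "a \<notin> \<int>\<^sub>\<le>\<^sub>0" and k: "j + m + k = n"
  shows "1 / pochhammer (a + of_nat j) m =
           pochhammer a j * Gamma a / Gamma (a + of_nat n) * pochhammer (a + of_nat (j + m)) k"
proof -
  have "pochhammer a n = pochhammer a j * pochhammer (a + of_nat j) m * pochhammer (a + of_nat (j + m)) k"
    using k by (auto simp: pochhammer_product' add.assoc)
  moreover have "Gamma (a + of_nat n) = Gamma a * pochhammer a n" "Gamma a \<noteq> 0"
    using a by (auto simp: pochhammer_Gamma Gamma_eq_zero_iff)
  ultimately show ?thesis
    using pochhammer_nonzero[OF a, of n] by (auto simp: field_simps)
qed

section \<open>The two closed forms\<close>

theorem theorem3p3: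
  fixes p :: complex and j n :: nat
  assumes "p \<noteq> 0" and "j \<le> n"
  shows "(\<forall>x::complex.
            HC p (of_nat j + 1/2) 0 (of_nat j - of_nat n) (4 * p * (of_nat j - of_nat n)) x
            = fact (2 * j) / fact j *
              (\<Sum>k = 0..n - j. of_nat ((n - j) choose k) * (fact (n - k) / fact (2 * n - 2 * k))
                               * (16 * p * x) ^ (n - j - k)))
       \<and> (\<forall>lam::real. lam > -1 \<longrightarrow> (\<forall>x::complex.
            HC p (of_nat j + 1 + of_real lam) 0 (of_nat j - of_nat n) (4 * p * (of_nat j - of_nat n)) x
            = pochhammer (of_real lam + 1) j * Gamma (of_real lam + 1) / Gamma (of_nat n + of_real lam + 1) *
              (\<Sum>k = 0..n - j. pochhammer (of_real lam + of_nat n + 1 - of_nat k) k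
                               * of_nat ((n - j) choose k) * (4 * p * x) ^ (n - j - k))))"
proof -
  define N where "N = n - j"
  have n: "n = j + N" using assms by (simp add: N_def)
  have \<alpha>: "of_nat j - of_nat n = (- of_nat N :: complex)" by (simp add: n)
  have nonpos: "a \<notin> \<int>\<^sub>\<le>\<^sub>0" if "Re a > 0" for a :: complex
    using that by (auto elim!: nonpos_Ints_cases)
  show ?thesis
    unfolding \<alpha> N_def[symmetric]
  proof (intro conjI allI impI)
    fix x
    have "of_nat j + 1/2 \<notin> (\<int>\<^sub>\<le>\<^sub>0 :: complex set)" by (rule nonpos) simp
    note HC_eq = HC_eq_confluent_poly[OF this, of p N]
    have "HC p (of_nat j + 1/2) 0 (- of_nat N) (4 * p * - of_nat N) x
            = (\<Sum>k = 0..N. of_nat (N choose k) / pochhammer (of_nat j + 1/2) (N - k)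
                            * (4 * p * x) ^ (N - k))"
      by (simp only: HC_eq confluent_poly_reversed)
    also have "\<dots> = (\<Sum>k = 0..N. fact (2 * j) / fact j * (of_nat (N choose k)
                 * (fact (n - k) / fact (2 * n - 2 * k)) * (16 * p * x) ^ (N - k)))"
    proof (rule sum.cong)
      fix k assume "k \<in> {0..N}"
      hence k: "n - k = j + (N - k)" "2 * n - 2 * k = 2 * (j + (N - k))" by (auto simp: n)
      have "(16 * p * x) ^ (N - k) = 4 ^ (N - k) * (4 * p * x) ^ (N - k)"
        unfolding power_mult_distrib[symmetric] by (simp only: mult.assoc[symmetric]) simp
      thus "of_nat (N choose k) / pochhammer (of_nat j + 1/2) (N - k) * (4 * p * x) ^ (N - k)
            = fact (2 * j) / fact j * (of_nat (N choose k)
                 * (fact (n - k) / fact (2 * n - 2 * k)) * (16 * p * x) ^ (N - k))"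
        unfolding k pochhammer_half_shifted by (simp only:) (simp add: divide_simps)
    qed simp
    finally show "HC p (of_nat j + 1/2) 0 (- of_nat N) (4 * p * - of_nat N) x
        = fact (2 * j) / fact j * (\<Sum>k = 0..N. of_nat (N choose k)
                 * (fact (n - k) / fact (2 * n - 2 * k)) * (16 * p * x) ^ (N - k))"
      by (simp only: sum_distrib_left)
  next
    fix lam :: real and x
    assume lam: "lam > -1"
    define a :: complex where "a = of_real lam + 1"
    have a: "a \<notin> \<int>\<^sub>\<le>\<^sub>0" "a + of_nat j \<notin> \<int>\<^sub>\<le>\<^sub>0"
      using lam by (auto intro!: nonpos simp: a_def)
    have shifts: "of_nat j + 1 + of_real lam = a + of_nat j"
      "of_nat n + of_real lam + 1 = a + of_nat n"
      by (simp_all add: a_def)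
    have "HC p (a + of_nat j) 0 (- of_nat N) (4 * p * - of_nat N) x
            = (\<Sum>k = 0..N. of_nat (N choose k) / pochhammer (a + of_nat j) (N - k)
                            * (4 * p * x) ^ (N - k))"
      by (simp only: HC_eq_confluent_poly[OF a(2), of p N] confluent_poly_reversed)
    also have "\<dots> = (\<Sum>k = 0..N. pochhammer a j * Gamma a / Gamma (a + of_nat n)
                 * (pochhammer (of_real lam + of_nat n + 1 - of_nat k) k
                      * of_nat (N choose k) * (4 * p * x) ^ (N - k)))"
    proof (rule sum.cong)
      fix k assume k: "k \<in> {0..N}"
      hence arg: "of_real lam + of_nat n + 1 - of_nat k = a + of_nat (j + (N - k))"
        by (simp add: n a_def of_nat_diff)
      have "of_nat (N choose k) / pochhammer (a + of_nat j) (N - k)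
              = of_nat (N choose k) * (1 / pochhammer (a + of_nat j) (N - k))"
        by simp
      also have "1 / pochhammer (a + of_nat j) (N - k)
              = pochhammer a j * Gamma a / Gamma (a + of_nat n)
                  * pochhammer (a + of_nat (j + (N - k))) k"
        using k by (intro inverse_pochhammer_Gamma a) (simp add: n)
      finally show "of_nat (N choose k) / pochhammer (a + of_nat j) (N - k) * (4 * p * x) ^ (N - k)
            = pochhammer a j * Gamma a / Gamma (a + of_nat n)
                 * (pochhammer (of_real lam + of_nat n + 1 - of_nat k) k
                      * of_nat (N choose k) * (4 * p * x) ^ (N - k))"
        unfolding arg by (simp only: mult_ac)
    qed simp
    finally show "HC p (of_nat j + 1 + of_real lam) 0 (- of_nat N) (4 * p * - of_nat N) x
        = pochhammer (of_real lam + 1) j * Gamma (of_real lam + 1) / Gamma (of_nat n + of_real lam + 1)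
            * (\<Sum>k = 0..N. pochhammer (of_real lam + of_nat n + 1 - of_nat k) k
                      * of_nat (N choose k) * (4 * p * x) ^ (N - k))"
      unfolding shifts by (simp only: sum_distrib_left a_def)
  qed
qed

end
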